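(* Let $\mu$ be a positive finite Borel measure on $[0,1)$, let $\mu_n=\int_0^1 t^n\,d\mu(t)$, $n\ge 0$, be its moments, and let $R_\mu$ be the Rhaly operator associated to the moment sequence $(\mu_n)_{n\ge 0}$. Assume that $R_\mu$ is a bounded operator on $\ell^2$, and let $$s_n=\sum_{j=0}^n \mu_j=\int_0^1\frac{1-t^{n+1}}{1-t}\,d\mu(t)\qquad(n\ge 0).$$ If $\lambda\in\sigma_p(R_\mu^* )$, then $\lambda\ne 0$. Moreover, let $\gamma>0$ be such that $(\exp(-(1+\epsilon)\gamma s_n))_{n\ge 0}$ is an $\ell^1$ sequence for all $\epsilon>0$. Then $$\{z\in\mathbb{C}:\ |z-1/\gamma|<1/\gamma\}\subseteq\sigma_p(R_\mu^* ).$$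
   Context: $\ell^2=\ell^2(\mathbb{N}_0)$ is the complex Hilbert space of square-summable sequences $(x_n)_{n\ge 0}$, and $\ell^1$ is the space of absolutely summable sequences. The Rhaly operator $R_\mu$ associated to the moment sequence $(\mu_n)_{n\ge 0}$ is given by the lower triangular matrix whose $(n,k)$ entry is $\mu_n$ for $0\le k\le n$ and $0$ for $k>n$, i.e. $(R_\mu x)_n=\mu_n\sum_{k=0}^n x_k$. $R_\mu^*$ is its Hilbert space adjoint and $\sigma_p(T)$ denotes the point spectrum (set of eigenvalues) of a bounded operator $T$. Here $0^0=1$, so that $\mu_0=\mu([0,1))$.
   Formalization: The claim that eigenvalues of the adjoint are non-zero is stated only for μ((0,1)) ≠ 0: if μ is a multiple of the point mass at 0, then R_μ x = (μ_0 x_0, 0, 0, …) is bounded and 0 is an eigenvalue of its adjoint. *)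

theory Defs
  imports "HOL-Analysis.Analysis"
begin

text \<open>The sequence spaces are carrier sets of functions on \<^typ>\<open>nat\<close>.\<close>

definition ell1 :: "(nat \<Rightarrow> 'a::real_normed_vector) set"
  where "ell1 = {x. summable (\<lambda>n. norm (x n))}"

definition ell2 :: "(nat \<Rightarrow> complex) set"
  where "ell2 = {x. summable (\<lambda>n. (cmod (x n))\<^sup>2)}"

definition ell2_norm :: "(nat \<Rightarrow> complex) \<Rightarrow> real"
  where "ell2_norm x = sqrt (\<Sum>n. (cmod (x n))\<^sup>2)"

definition ell2_inner :: "(nat \<Rightarrow> complex) \<Rightarrow> (nat \<Rightarrow> complex) \<Rightarrow> complex"
  where "ell2_inner x y = (\<Sum>n. x n * cnj (y n))"

text \<open>An operator on \<open>\<ell>\<^sup>2\<close> is a map on all sequences, of which only the values on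
  \<^const>\<open>ell2\<close> are relevant.\<close>

definition ell2_bounded_operator :: "((nat \<Rightarrow> complex) \<Rightarrow> (nat \<Rightarrow> complex)) \<Rightarrow> bool"
  where "ell2_bounded_operator T \<longleftrightarrow>
    (\<forall>x\<in>ell2. T x \<in> ell2) \<and>
    (\<forall>x\<in>ell2. \<forall>y\<in>ell2. \<forall>a b. T (\<lambda>n. a * x n + b * y n) = (\<lambda>n. a * T x n + b * T y n)) \<and>
    (\<exists>C. \<forall>x\<in>ell2. ell2_norm (T x) \<le> C * ell2_norm x)"

text \<open>The Hilbert space adjoint. For a bounded operator \<open>T\<close> and \<open>y\<close> in \<^const>\<open>ell2\<close> the
  described sequence exists and is unique, by the Riesz representation theorem; for other
  arguments the value is unspecified.\<close>

definition ell2_adjoint :: "((nat \<Rightarrow> complex) \<Rightarrow> (nat \<Rightarrow> complex)) \<Rightarrow> (nat \<Rightarrow> complex) \<Rightarrow> (nat \<Rightarrow> complex)"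
  where "ell2_adjoint T y = (THE z. z \<in> ell2 \<and> (\<forall>x\<in>ell2. ell2_inner (T x) y = ell2_inner x z))"

definition point_spectrum :: "((nat \<Rightarrow> complex) \<Rightarrow> (nat \<Rightarrow> complex)) \<Rightarrow> complex set"
  where "point_spectrum T = {z. \<exists>x\<in>ell2. x \<noteq> (\<lambda>n. 0) \<and> T x = (\<lambda>n. z * x n)}"

definition moment :: "real measure \<Rightarrow> nat \<Rightarrow> real"
  where "moment M n = (\<integral>t. t ^ n \<partial>M)"

definition rhaly :: "(nat \<Rightarrow> complex) \<Rightarrow> (nat \<Rightarrow> complex) \<Rightarrow> (nat \<Rightarrow> complex)"
  where "rhaly a x = (\<lambda>n. a n * (\<Sum>k\<le>n. x k))"

definition rhaly_moment :: "real measure \<Rightarrow> (nat \<Rightarrow> complex) \<Rightarrow> (nat \<Rightarrow> complex)"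
  where "rhaly_moment M = rhaly (\<lambda>n. of_real (moment M n))"

end

theory Submission
  imports Defs
begin

text \<open>The adjoint of a Rhaly operator sends \<open>y\<close> to the sequence of tails
  \<open>\<Sum>\<^bsub>n\<ge>k\<^esub> \<mu>\<^sub>n y\<^sub>n\<close>. Differencing the eigenvalue equation gives
  \<open>y\<^bsub>k+1\<^esub> = (1 - \<mu>\<^sub>k / \<lambda>) y\<^sub>k\<close>, so an eigenvector must be a multiple of
  \<open>\<Prod>\<^bsub>j<k\<^esub> (1 - \<mu>\<^sub>j / \<lambda>)\<close>. Since \<open>(\<mu>\<^sub>n)\<close> is square summable, the square of its modulus is
  at most a constant times \<open>exp (- 2 Re (1/\<lambda>) s\<^bsub>k-1\<^esub>)\<close>, and the disc is exactly the region
  \<open>2 Re (1/\<lambda>) > \<gamma>\<close>.\<close>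

section \<open>Inner product and Cauchy-Schwarz inequality on \<open>ell2\<close>\<close>

lemma ell2_summable_norm_mult:
  assumes "x \<in> ell2" "y \<in> ell2"
  shows "summable (\<lambda>n. cmod (x n) * cmod (y n))"
proof (rule summable_comparison_test')
  show "summable (\<lambda>n. (cmod (x n))\<^sup>2 + (cmod (y n))\<^sup>2)"
    using assms unfolding ell2_def by (intro summable_add) auto
  have "2 * (a * b) \<le> a\<^sup>2 + b\<^sup>2" for a b :: real
    using sum_squares_bound[of a b] by simp
  then have *: "a * b \<le> a\<^sup>2 + b\<^sup>2" if "a \<ge> 0" "b \<ge> 0" for a b :: real
    using mult_nonneg_nonneg[OF that] by (smt (verit))
  show "norm (cmod (x n) * cmod (y n)) \<le> (cmod (x n))\<^sup>2 + (cmod (y n))\<^sup>2" for n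
    using *[of "cmod (x n)" "cmod (y n)"] by simp
qed

lemma ell2_summable_inner:
  assumes "x \<in> ell2" "y \<in> ell2"
  shows "summable (\<lambda>n. x n * cnj (y n))"
  by (rule summable_norm_cancel) (use ell2_summable_norm_mult[OF assms] in \<open>simp add: norm_mult\<close>)

lemma ell2_norm_nonneg: "x \<in> ell2 \<Longrightarrow> 0 \<le> ell2_norm x"
  unfolding ell2_def ell2_norm_def by (auto intro: suminf_nonneg)

text \<open>The finite inequality \<open>L2_set_mult_ineq\<close> bounds every partial sum by the
  same product of norms, and the bound survives in the limit.\<close>

lemma ell2_inner_Cauchy_Schwarz:
  assumes "x \<in> ell2" "y \<in> ell2"
  shows "cmod (ell2_inner x y) \<le> ell2_norm x * ell2_norm y"
proof -
  have "cmod (ell2_inner x y) \<le> (\<Sum>n. cmod (x n) * cmod (y n))"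
    unfolding ell2_inner_def
    using summable_norm[of "\<lambda>n. x n * cnj (y n)"] ell2_summable_norm_mult[OF assms]
    by (simp add: norm_mult)
  also have "\<dots> \<le> ell2_norm x * ell2_norm y"
  proof (rule suminf_le_const[OF ell2_summable_norm_mult[OF assms]])
    fix N
    have "(\<Sum>i<N. cmod (x i) * cmod (y i))
        \<le> L2_set (\<lambda>i. cmod (x i)) {..<N} * L2_set (\<lambda>i. cmod (y i)) {..<N}"
      using L2_set_mult_ineq[of "\<lambda>i. cmod (x i)" "\<lambda>i. cmod (y i)" "{..<N}"] by simp
    also have "\<dots> \<le> ell2_norm x * ell2_norm y"
      unfolding L2_set_def ell2_norm_def using assms
      by (intro mult_mono real_sqrt_le_mono sum_le_suminf)
        (auto simp: ell2_def intro!: sum_nonneg suminf_nonneg)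
    finally show "(\<Sum>i<N. cmod (x i) * cmod (y i)) \<le> ell2_norm x * ell2_norm y" .
  qed
  finally show ?thesis .
qed

section \<open>Truncations and density of finitely supported sequences\<close>

lemma ell2_finite_support:
  assumes "\<And>n. n \<ge> N \<Longrightarrow> x n = 0"
  shows "x \<in> ell2"
  unfolding ell2_def using summable_finite[of "{..<N}" "\<lambda>n. (cmod (x n))\<^sup>2"] assms
  by (simp add: not_less)

text \<open>Truncations reduce inner products to finite sums; identities checked on them extend to
  all of \<open>ell2\<close> by density.\<close>

definition truncate :: "nat \<Rightarrow> (nat \<Rightarrow> complex) \<Rightarrow> nat \<Rightarrow> complex"
  where "truncate N x = (\<lambda>n. if n < N then x n else 0)"

lemma truncate_ell2: "truncate N x \<in> ell2"
  by (rule ell2_finite_support[of N]) (simp add: truncate_def)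

lemma ell2_norm_truncate: "ell2_norm (truncate N x) = sqrt (\<Sum>n<N. (cmod (x n))\<^sup>2)"
proof -
  have "(\<Sum>n. (cmod (truncate N x n))\<^sup>2) = (\<Sum>n<N. (cmod (truncate N x n))\<^sup>2)"
    by (rule suminf_finite) (auto simp: truncate_def)
  then show ?thesis
    unfolding ell2_norm_def by (simp add: truncate_def)
qed

lemma ell2_inner_truncate: "ell2_inner (truncate N x) y = (\<Sum>n<N. x n * cnj (y n))"
proof -
  have "ell2_inner (truncate N x) y = (\<Sum>n<N. truncate N x n * cnj (y n))"
    unfolding ell2_inner_def by (rule suminf_finite) (auto simp: truncate_def)
  then show ?thesis
    by (simp add: truncate_def)
qed

lemma ell2_diff_truncate:
  assumes "x \<in> ell2"
  shows "(\<lambda>n. x n - truncate N x n) \<in> ell2"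
    and "ell2_norm (\<lambda>n. x n - truncate N x n) = sqrt (\<Sum>n. (cmod (x (n + N)))\<^sup>2)"
proof -
  let ?f = "\<lambda>n. (cmod (x n - truncate N x n))\<^sup>2"
  have tail: "?f (n + N) = (cmod (x (n + N)))\<^sup>2" for n
    by (simp add: truncate_def)
  have "summable (\<lambda>n. (cmod (x (n + N)))\<^sup>2)"
    using assms unfolding ell2_def by (simp add: summable_iff_shift[of "\<lambda>n. (cmod (x n))\<^sup>2"])
  then have *: "summable ?f"
    using summable_iff_shift[of ?f N] unfolding tail by blast
  then show "(\<lambda>n. x n - truncate N x n) \<in> ell2"
    by (simp add: ell2_def)
  have "(\<Sum>n<N. ?f n) = 0"
    by (rule sum.neutral) (simp add: truncate_def)
  then show "ell2_norm (\<lambda>n. x n - truncate N x n) = sqrt (\<Sum>n. (cmod (x (n + N)))\<^sup>2)"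
    using suminf_split_initial_segment[OF *, of N] unfolding ell2_norm_def tail by simp
qed

text \<open>Density of the truncations: the squared distance is the tail of a convergent
  series.\<close>

lemma ell2_norm_diff_truncate_tendsto_0:
  assumes "x \<in> ell2"
  shows "(\<lambda>N. ell2_norm (\<lambda>n. x n - truncate N x n)) \<longlonglongrightarrow> 0"
proof -
  have s: "summable (\<lambda>n. (cmod (x n))\<^sup>2)"
    using assms by (simp add: ell2_def)
  have "(\<lambda>N. (\<Sum>n. (cmod (x n))\<^sup>2) - (\<Sum>n<N. (cmod (x n))\<^sup>2)) \<longlonglongrightarrow> 0"
    using tendsto_diff[OF tendsto_const summable_LIMSEQ[OF s], of "\<Sum>n. (cmod (x n))\<^sup>2"] by simp
  then have "(\<lambda>N. \<Sum>n. (cmod (x (n + N)))\<^sup>2) \<longlonglongrightarrow> 0"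
    by (simp add: suminf_minus_initial_segment[OF s])
  from tendsto_real_sqrt[OF this] show ?thesis
    by (simp add: ell2_diff_truncate(2)[OF assms])
qed

lemma ell2_bounded_operator_diff:
  assumes "ell2_bounded_operator T" "x \<in> ell2" "y \<in> ell2"
  shows "T (\<lambda>n. x n - y n) = (\<lambda>n. T x n - T y n)"
proof -
  have "T (\<lambda>n. 1 * x n + (- 1) * y n) = (\<lambda>n. 1 * T x n + (- 1) * T y n)"
    using assms unfolding ell2_bounded_operator_def by blast
  then show ?thesis
    by simp
qed

text \<open>Testing against the unit vectors recovers every entry. This is the uniqueness half of
  the adjoint.\<close>

lemma ell2_inner_eq_imp_eq:
  assumes "\<And>x. x \<in> ell2 \<Longrightarrow> ell2_inner x y = ell2_inner x z"
  shows "y = z"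
proof
  fix k
  have e: "ell2_inner (\<lambda>n. if n = k then 1 else 0) w = cnj (w k)" for w
    unfolding ell2_inner_def
    by (subst suminf_finite[of "{k}"]) auto
  have "(\<lambda>n. if n = k then 1 else 0) \<in> ell2"
    by (rule ell2_finite_support[of "Suc k"]) auto
  from assms[OF this] show "y k = z k"
    by (simp add: e)
qed

section \<open>The adjoint of a bounded Rhaly operator\<close>

text \<open>The weights form the first column of the matrix, that is, the image of the unit vector
  at index 0.\<close>

lemma rhaly_bounded_imp_weights_ell2:
  assumes "ell2_bounded_operator (rhaly a)"
  shows "a \<in> ell2"
proof -
  let ?e = "\<lambda>n. if n = 0 then 1 else 0 :: complex"
  have "?e \<in> ell2"
    by (rule ell2_finite_support[of 1]) auto
  then have "rhaly a ?e \<in> ell2"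
    using assms unfolding ell2_bounded_operator_def by blast
  moreover have "rhaly a ?e = a"
    by (simp add: rhaly_def fun_eq_iff)
  ultimately show ?thesis
    by simp
qed

text \<open>The conjugate transpose of the Rhaly matrix: row \<open>k\<close> only meets the indices
  from \<open>k\<close> on.\<close>

definition rhaly_tails :: "(nat \<Rightarrow> complex) \<Rightarrow> (nat \<Rightarrow> complex) \<Rightarrow> nat \<Rightarrow> complex"
  where "rhaly_tails a y = (\<lambda>k. \<Sum>n. cnj (a (n + k)) * y (n + k))"

text \<open>Padding the tail with \<open>k\<close> zeros lets all tails run over the same index
  \<open>n\<close>, so that they can be added term by term.\<close>

lemma cnj_rhaly_tails_sums:
  assumes "a \<in> ell2" "y \<in> ell2"
  shows "(\<lambda>n. if k \<le> n then a n * cnj (y n) else 0) sums cnj (rhaly_tails a y k)"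
proof -
  have "summable (\<lambda>n. a (n + k) * cnj (y (n + k)))"
    using ell2_summable_inner[OF assms] summable_iff_shift[of "\<lambda>n. a n * cnj (y n)"] by blast
  then have "(\<lambda>n. a (n + k) * cnj (y (n + k))) sums (\<Sum>n. a (n + k) * cnj (y (n + k)))"
    by (rule summable_sums)
  moreover from sums_cnj[THEN iffD2, OF this]
  have "(\<lambda>n. cnj (a (n + k)) * y (n + k)) sums cnj (\<Sum>n. a (n + k) * cnj (y (n + k)))"
    by simp
  then have "rhaly_tails a y k = cnj (\<Sum>n. a (n + k) * cnj (y (n + k)))"
    unfolding rhaly_tails_def by (rule sums_unique[symmetric])
  ultimately have "(\<lambda>n. a (n + k) * cnj (y (n + k))) sums cnj (rhaly_tails a y k)"
    by simp
  \<comment> \<open>The condition always holds here; it is inserted to match the padded sequence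
    shifted by \<open>k\<close>, whose first \<open>k\<close> terms vanish.\<close>
  then have "(\<lambda>n. if k \<le> n + k then a (n + k) * cnj (y (n + k)) else 0)
      sums cnj (rhaly_tails a y k)"
    by simp
  then show ?thesis
    by (subst (asm) sums_zero_iff_shift) auto
qed

text \<open>On a truncation the sum over \<open>k\<close> is finite, so exchanging it with the
  series over \<open>n\<close> is mere linearity of \<open>sums\<close>.\<close>

lemma ell2_inner_rhaly_truncate:
  assumes "a \<in> ell2" "y \<in> ell2"
  shows "ell2_inner (rhaly a (truncate N x)) y = ell2_inner (truncate N x) (rhaly_tails a y)"
proof -
  have eq: "rhaly a (truncate N x) n * cnj (y n)
      = (\<Sum>k<N. x k * (if k \<le> n then a n * cnj (y n) else 0))" for n
  proof -
    have "(\<Sum>k\<le>n. truncate N x k) = (\<Sum>k<N. if k \<le> n then x k else 0)"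
      unfolding truncate_def
      by (simp add: sum.inter_filter[symmetric]) (auto intro: sum.cong)
    then show ?thesis
      unfolding rhaly_def by (auto simp: sum_distrib_left sum_distrib_right intro!: sum.cong)
  qed
  have "(\<lambda>n. \<Sum>k<N. x k * (if k \<le> n then a n * cnj (y n) else 0))
      sums (\<Sum>k<N. x k * cnj (rhaly_tails a y k))"
    by (intro sums_sum sums_mult cnj_rhaly_tails_sums assms)
  then show ?thesis
    unfolding ell2_inner_truncate unfolding ell2_inner_def eq by (rule sums_unique[symmetric])
qed

text \<open>Duality argument: pairing the tails with their own truncation gives
  \<open>S \<le> C * sqrt S * ell2_norm y\<close> for the partial sum \<open>S\<close> of squares,
  hence a bound independent of \<open>N\<close>.\<close>

lemma rhaly_tails_ell2:
  assumes "ell2_bounded_operator (rhaly a)" "y \<in> ell2"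
  shows "rhaly_tails a y \<in> ell2"
proof -
  obtain C where C: "\<And>x. x \<in> ell2 \<Longrightarrow> ell2_norm (rhaly a x) \<le> C * ell2_norm x"
    using assms(1) unfolding ell2_bounded_operator_def by blast
  let ?z = "rhaly_tails a y"
  have a: "a \<in> ell2"
    using assms(1) by (rule rhaly_bounded_imp_weights_ell2)
  have bound: "(\<Sum>n<N. (cmod (?z n))\<^sup>2) \<le> (C * ell2_norm y)\<^sup>2" for N
  proof -
    define S where "S = (\<Sum>n<N. (cmod (?z n))\<^sup>2)"
    have S0: "S \<ge> 0"
      unfolding S_def by (simp add: sum_nonneg)
    have nS: "ell2_norm (truncate N ?z) = sqrt S"
      by (simp add: ell2_norm_truncate S_def)
    have "of_real S = ell2_inner (truncate N ?z) ?z"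
      by (simp only: ell2_inner_truncate S_def of_real_sum complex_norm_square)
    also have "\<dots> = ell2_inner (rhaly a (truncate N ?z)) y"
      by (rule ell2_inner_rhaly_truncate[OF a assms(2), symmetric])
    finally have "S = cmod (ell2_inner (rhaly a (truncate N ?z)) y)"
      using S0 by (metis norm_of_real abs_of_nonneg)
    also have "\<dots> \<le> ell2_norm (rhaly a (truncate N ?z)) * ell2_norm y"
      using assms truncate_ell2 unfolding ell2_bounded_operator_def
      by (intro ell2_inner_Cauchy_Schwarz) auto
    also have "\<dots> \<le> (C * sqrt S) * ell2_norm y"
      using C[OF truncate_ell2, of N ?z] ell2_norm_nonneg[OF assms(2)]
      unfolding nS by (intro mult_right_mono)
    finally have *: "sqrt S * sqrt S \<le> sqrt S * (C * ell2_norm y)"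
      using S0 by (simp add: mult_ac)
    show "S \<le> (C * ell2_norm y)\<^sup>2"
    \<comment> \<open>Cancelling \<open>sqrt S\<close> requires it to be positive.\<close>
    proof (cases "S = 0")
      case False
      then have "sqrt S \<le> C * ell2_norm y"
        using mult_le_cancel_left_pos[THEN iffD1, OF _ *] S0 by simp
      then show ?thesis
        using S0 by (simp add: sqrt_le_D)
    qed simp
  qed
  show ?thesis
    unfolding ell2_def by (auto intro!: summableI_nonneg_bounded[OF _ bound])
qed

text \<open>Both sides are continuous in \<open>x\<close>, by boundedness and Cauchy-Schwarz, and
  they agree on truncations.\<close>

lemma ell2_inner_rhaly:
  assumes "ell2_bounded_operator (rhaly a)" "x \<in> ell2" "y \<in> ell2"
  shows "ell2_inner (rhaly a x) y = ell2_inner x (rhaly_tails a y)"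
proof -
  obtain C where C: "\<And>x. x \<in> ell2 \<Longrightarrow> ell2_norm (rhaly a x) \<le> C * ell2_norm x"
    using assms(1) unfolding ell2_bounded_operator_def by blast
  have R: "rhaly a u \<in> ell2" if "u \<in> ell2" for u
    using assms(1) that unfolding ell2_bounded_operator_def by blast
  let ?z = "rhaly_tails a y"
  define d where "d N = (\<lambda>n. x n - truncate N x n)" for N
  \<comment> \<open>The first summand bounds the pairing of \<open>rhaly a (d N)\<close> with
    \<open>y\<close>, the second that of \<open>d N\<close> with the tails.\<close>
  define K where "K = C * ell2_norm y + ell2_norm ?z"
  have d: "d N \<in> ell2" for N
    unfolding d_def by (rule ell2_diff_truncate(1)[OF assms(2)])
  have z: "?z \<in> ell2"
    using assms(1,3) by (rule rhaly_tails_ell2)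
  have inner_diff: "ell2_inner (\<lambda>n. u n - v n) w = ell2_inner u w - ell2_inner v w"
    if "u \<in> ell2" "v \<in> ell2" "w \<in> ell2" for u v w
    unfolding ell2_inner_def left_diff_distrib
    using that by (intro suminf_diff[symmetric] ell2_summable_inner)
  have bound: "cmod (ell2_inner (rhaly a x) y - ell2_inner x ?z) \<le> K * ell2_norm (d N)" for N
  proof -
    \<comment> \<open>The contributions of \<open>truncate N x\<close> cancel, so the defect of
      \<open>x\<close> equals the defect of the remainder \<open>d N\<close> for every
      \<open>N\<close>.\<close>
    have "ell2_inner (rhaly a x) y - ell2_inner x ?z
        = ell2_inner (rhaly a (d N)) y - ell2_inner (d N) ?z"
      unfolding d_def ell2_bounded_operator_diff[OF assms(1,2) truncate_ell2]
      using assms z R truncate_ell2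
        ell2_inner_rhaly_truncate[OF rhaly_bounded_imp_weights_ell2[OF assms(1)] assms(3)]
      by (simp add: inner_diff)
    also have "cmod \<dots> \<le> cmod (ell2_inner (rhaly a (d N)) y) + cmod (ell2_inner (d N) ?z)"
      by (rule norm_triangle_ineq4)
    also have "\<dots> \<le> ell2_norm (rhaly a (d N)) * ell2_norm y + ell2_norm (d N) * ell2_norm ?z"
      by (intro add_mono ell2_inner_Cauchy_Schwarz R d z assms)
    also have "\<dots> \<le> (C * ell2_norm (d N)) * ell2_norm y + ell2_norm (d N) * ell2_norm ?z"
      by (intro add_right_mono mult_right_mono C d ell2_norm_nonneg assms)
    finally show ?thesis
      by (simp add: K_def algebra_simps)
  qed
  have "(\<lambda>N. K * ell2_norm (d N)) \<longlonglongrightarrow> K * 0"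
    unfolding d_def by (intro tendsto_intros ell2_norm_diff_truncate_tendsto_0 assms)
  then have "cmod (ell2_inner (rhaly a x) y - ell2_inner x ?z) \<le> K * 0"
    by (rule LIMSEQ_le_const) (use bound in auto)
  then show ?thesis
    by simp
qed

text \<open>Existence and uniqueness are both available now, so the definite description in
  \<open>ell2_adjoint\<close> can be evaluated.\<close>

lemma ell2_adjoint_rhaly:
  assumes "ell2_bounded_operator (rhaly a)" "y \<in> ell2"
  shows "ell2_adjoint (rhaly a) y = rhaly_tails a y"
  unfolding ell2_adjoint_def
proof (rule the_equality)
  show "rhaly_tails a y \<in> ell2 \<and>
      (\<forall>x\<in>ell2. ell2_inner (rhaly a x) y = ell2_inner x (rhaly_tails a y))"
    using assms by (simp add: rhaly_tails_ell2 ell2_inner_rhaly)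
next
  fix z assume "z \<in> ell2 \<and> (\<forall>x\<in>ell2. ell2_inner (rhaly a x) y = ell2_inner x z)"
  then show "z = rhaly_tails a y"
    using assms by (intro ell2_inner_eq_imp_eq) (simp add: ell2_inner_rhaly)
qed

section \<open>Eigenvalues of the adjoint\<close>

lemma rhaly_tails_Suc:
  assumes "a \<in> ell2" "y \<in> ell2"
  shows "rhaly_tails a y k - rhaly_tails a y (Suc k) = cnj (a k) * y k"
proof -
  have "summable (\<lambda>n. cnj (a n) * y n)"
    using sums_cnj[THEN iffD2, OF summable_sums[OF ell2_summable_inner[OF assms]]]
    by (simp add: sums_iff)
  then have "summable (\<lambda>n. cnj (a (n + k)) * y (n + k))"
    using summable_iff_shift[of "\<lambda>n. cnj (a n) * y n"] by blast
  from suminf_split_head[OF this] show ?thesis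
    unfolding rhaly_tails_def by simp
qed

text \<open>For eigenvalue 0 all tails of the eigenvector vanish, hence so do their differences
  \<open>cnj (a k) * x k\<close>; nonzero weights then force \<open>x\<close> to vanish.\<close>

lemma point_spectrum_adjoint_rhaly_nonzero:
  assumes "ell2_bounded_operator (rhaly a)" "\<And>n. a n \<noteq> 0"
    and "z \<in> point_spectrum (ell2_adjoint (rhaly a))"
  shows "z \<noteq> 0"
proof
  assume "z = 0"
  then obtain x where x: "x \<in> ell2" "x \<noteq> (\<lambda>n. 0)" "ell2_adjoint (rhaly a) x = (\<lambda>n. 0)"
    using assms(3) unfolding point_spectrum_def by auto
  then have "rhaly_tails a x = (\<lambda>n. 0)"
    using ell2_adjoint_rhaly[OF assms(1)] by simp
  then have "cnj (a k) * x k = 0" for k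
    using rhaly_tails_Suc[OF rhaly_bounded_imp_weights_ell2[OF assms(1)] x(1), of k] by simp
  then have "x = (\<lambda>n. 0)"
    using assms(2) by (simp add: fun_eq_iff)
  with x(2) show False ..
qed

text \<open>The product satisfies the differenced eigenvalue equation by construction. Summing it
  back to the equation itself needs \<open>y\<close> to tend to 0, which square summability
  supplies.\<close>

lemma point_spectrum_adjoint_rhalyI:
  fixes a :: "nat \<Rightarrow> complex" and \<nu> :: complex
  defines "y \<equiv> \<lambda>k. \<Prod>j<k. (1 - cnj (a j) / \<nu>)"
  assumes "ell2_bounded_operator (rhaly a)" "\<nu> \<noteq> 0" "y \<in> ell2"
  shows "\<nu> \<in> point_spectrum (ell2_adjoint (rhaly a))"
proof -
  \<comment> \<open>The empty product is 1, so \<open>y\<close> is nonzero even if some later factor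
    vanishes.\<close>
  have "y 0 \<noteq> 0"
    by (simp add: y_def)
  then have nz: "y \<noteq> (\<lambda>n. 0)"
    by metis
  have diff: "cnj (a k) * y k = \<nu> * y k - \<nu> * y (Suc k)" for k
    using assms(3) by (simp add: y_def field_simps)
  have "(\<lambda>n. (cmod (y n))\<^sup>2) \<longlonglongrightarrow> 0"
    using assms(4) summable_LIMSEQ_zero unfolding ell2_def by blast
  then have "(\<lambda>n. sqrt ((cmod (y n))\<^sup>2)) \<longlonglongrightarrow> sqrt 0"
    by (rule tendsto_real_sqrt)
  then have "y \<longlonglongrightarrow> 0"
    by (simp add: tendsto_norm_zero_iff)
  then have lim: "(\<lambda>n. \<nu> * y n) \<longlonglongrightarrow> 0"
    by (rule tendsto_mult_right_zero)
  have "rhaly_tails a y k = \<nu> * y k" for k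
  proof -
    have "(\<lambda>n. \<nu> * y (n + k)) \<longlonglongrightarrow> 0"
      by (rule LIMSEQ_ignore_initial_segment[OF lim])
    \<comment> \<open>Telescoping from index \<open>k\<close> leaves \<open>\<nu> * y k\<close>
      minus the limit, which is 0.\<close>
    from telescope_sums'[OF this]
    have "(\<lambda>n. cnj (a (n + k)) * y (n + k)) sums (\<nu> * y k)"
      by (simp add: diff)
    then show ?thesis
      unfolding rhaly_tails_def by (rule sums_unique[symmetric])
  qed
  then have "ell2_adjoint (rhaly a) y = (\<lambda>n. \<nu> * y n)"
    using ell2_adjoint_rhaly[OF assms(2,4)] by (simp add: fun_eq_iff)
  then show ?thesis
    using assms(4) nz unfolding point_spectrum_def by blast
qed

section \<open>Square summability of the product\<close>

text \<open>Each squared factor is \<open>1 + u\<close> with \<open>u\<close> consisting of a linear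
  and a quadratic term in \<open>m j\<close>. By \<open>1 + u \<le> exp u\<close>, the linear terms
  add up to the summable exponential and the quadratic ones stay bounded.\<close>

lemma ell2_prod_one_minus:
  fixes m :: "nat \<Rightarrow> real" and w :: complex
  assumes sq: "summable (\<lambda>n. (m n)\<^sup>2)"
    and ex: "summable (\<lambda>n. exp (- (2 * Re w * (\<Sum>j\<le>n. m j))))"
  shows "(\<lambda>k. \<Prod>j<k. (1 - of_real (m j) * w)) \<in> ell2"
proof -
  let ?y = "\<lambda>k. \<Prod>j<k. (1 - of_real (m j) * w)"
  \<comment> \<open>Total of the quadratic terms over all \<open>j\<close>, finite by
    \<open>sq\<close>.\<close>
  define B where "B = (cmod w)\<^sup>2 * (\<Sum>n. (m n)\<^sup>2)"
  have factor: "(cmod (1 - of_real (m j) * w))\<^sup>2 \<le> exp (- (2 * Re w * m j) + (cmod w)\<^sup>2 * (m j)\<^sup>2)" for j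
  proof -
    have "(cmod (1 - of_real (m j) * w))\<^sup>2 = 1 + (- (2 * Re w * m j) + (cmod w)\<^sup>2 * (m j)\<^sup>2)"
      unfolding cmod_power2 by (simp add: power2_eq_square algebra_simps)
    then show ?thesis
      using exp_ge_add_one_self by metis
  qed
  \<comment> \<open>The index is \<open>Suc k\<close> because \<open>?y (Suc k)\<close> has exactly
    the factors \<open>j \<le> k\<close> that occur in the exponent.\<close>
  have bound: "(cmod (?y (Suc k)))\<^sup>2 \<le> exp B * exp (- (2 * Re w * (\<Sum>j\<le>k. m j)))" for k
  proof -
    have "(cmod (?y (Suc k)))\<^sup>2 = (\<Prod>j\<le>k. (cmod (1 - of_real (m j) * w))\<^sup>2)"
      by (simp add: prod_norm[symmetric] prod_power_distrib lessThan_Suc_atMost)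
    also have "\<dots> \<le> (\<Prod>j\<le>k. exp (- (2 * Re w * m j) + (cmod w)\<^sup>2 * (m j)\<^sup>2))"
      by (intro prod_mono) (use factor in auto)
    also have "\<dots> = exp ((cmod w)\<^sup>2 * (\<Sum>j\<le>k. (m j)\<^sup>2)) * exp (- (2 * Re w * (\<Sum>j\<le>k. m j)))"
      by (simp add: exp_sum[symmetric] exp_add[symmetric] sum_subtractf sum_distrib_left)
    also have "\<dots> \<le> exp B * exp (- (2 * Re w * (\<Sum>j\<le>k. m j)))"
      unfolding B_def by (intro mult_right_mono) (auto intro!: mult_left_mono sum_le_suminf sq)
    finally show ?thesis .
  qed
  have "summable (\<lambda>k. (cmod (?y (Suc k)))\<^sup>2)"
    by (rule summable_comparison_test'[OF summable_mult[OF ex, of "exp B"]])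
      (use bound in auto)
  then show ?thesis
    unfolding ell2_def by (simp only: summable_Suc_iff[of "\<lambda>k. (cmod (?y k))\<^sup>2"] mem_Collect_eq)
qed

section \<open>The disc as the preimage of a half-plane\<close>

text \<open>Inversion sends a disc whose boundary passes through 0 to a half-plane. Expanding the
  square turns the hypothesis into \<open>(cmod z)\<^sup>2 < 2 * r * Re z\<close>; dividing by
  \<open>(cmod z)\<^sup>2\<close> gives the claim.\<close>

lemma Re_inverse_gt_of_disc:
  fixes z :: complex and r :: real
  assumes "cmod (z - of_real r) < r"
  shows "z \<noteq> 0" "1 / r < 2 * Re (1 / z)"
proof -
  have r: "r > 0"
    using assms norm_ge_zero[of "z - of_real r"] by linarith
  show z: "z \<noteq> 0"
    using assms r by auto
  have "(cmod (z - of_real r))\<^sup>2 < r\<^sup>2"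
    using assms by (intro power_strict_mono) auto
  then have "(cmod z)\<^sup>2 < 2 * r * Re z"
    unfolding cmod_power2 by (simp add: power2_eq_square algebra_simps)
  moreover have "Re (1 / z) = Re z / (cmod z)\<^sup>2"
    by (simp add: Re_divide cmod_power2)
  then have "Re z = Re (1 / z) * (cmod z)\<^sup>2"
    using z by simp
  ultimately have "1 * (cmod z)\<^sup>2 < (2 * r * Re (1 / z)) * (cmod z)\<^sup>2"
    by (simp add: mult.assoc)
  then have "1 < 2 * r * Re (1 / z)"
    by (rule mult_right_less_imp_less) simp
  then show "1 / r < 2 * Re (1 / z)"
    using r by (simp add: pos_divide_less_eq mult_ac)
qed

section \<open>Moments of a finite measure on [0,1)\<close>

context
  fixes M :: "real measure"
  assumes sets_M: "sets M = sets (restrict_space borel {0..<1})"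
    and finite_M: "finite_measure M"
begin

lemma space_unit_interval: "space M = {0..<1}"
  using sets_eq_imp_space_eq[OF sets_M] by (simp add: space_restrict_space)

lemma borel_measurable_unit_interval:
  fixes f :: "real \<Rightarrow> real"
  assumes "f \<in> borel_measurable borel"
  shows "f \<in> borel_measurable M"
  using measurable_restrict_space1[OF assms, of "{0..<1}"] measurable_cong_sets[OF sets_M refl] by blast

lemma integrable_power_unit_interval: "integrable M (\<lambda>t. t ^ n)"
proof (rule finite_measure.integrable_const_bound[OF finite_M, of _ 1])
  show "AE t in M. norm (t ^ n) \<le> 1"
    using space_unit_interval by (intro AE_I2) (auto simp: power_le_one)
qed (auto intro: borel_measurable_unit_interval)

lemma sum_moment_eq: "(\<Sum>j\<le>n. moment M j) = (\<integral>t. (1 - t ^ (n + 1)) / (1 - t) \<partial>M)"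
proof -
  have "(\<Sum>j\<le>n. moment M j) = (\<integral>t. (\<Sum>j\<le>n. t ^ j) \<partial>M)"
    unfolding moment_def
    by (rule Bochner_Integration.integral_sum[symmetric]) (rule integrable_power_unit_interval)
  also have "\<dots> = (\<integral>t. (1 - t ^ (n + 1)) / (1 - t) \<partial>M)"
  proof (rule Bochner_Integration.integral_cong[OF refl])
    fix t assume "t \<in> space M"
    \<comment> \<open>The right endpoint is excluded from the space, so the closed form of the
      geometric sum applies at every point.\<close>
    then have "t \<noteq> 1"
      using space_unit_interval by auto
    then show "(\<Sum>j\<le>n. t ^ j) = (1 - t ^ (n + 1)) / (1 - t)"
      by (simp add: sum_gp0)
  qed
  finally show ?thesis .
qed

text \<open>A vanishing integral of the nonnegative \<open>t ^ n\<close> makes it zero almost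
  everywhere; being positive on (0,1), it would make that interval a null set.\<close>

lemma moment_nonzero:
  assumes "emeasure M {0<..<1} \<noteq> 0"
  shows "moment M n \<noteq> 0"
proof
  assume "moment M n = 0"
  moreover have "AE t in M. 0 \<le> t ^ n"
    using space_unit_interval by (intro AE_I2) auto
  ultimately have "AE t in M. t ^ n = 0"
    using integral_nonneg_eq_0_iff_AE[OF integrable_power_unit_interval]
    unfolding moment_def by blast
  then have "AE t in M. t \<notin> {0<..<1}"
    by (rule AE_mp) (auto intro!: AE_I2)
  moreover have "{0<..<1} \<in> sets M"
    unfolding sets_M by (subst sets_restrict_space_iff) auto
  moreover have "{t \<in> space M. \<not> t \<notin> {0<..<1}} = {0<..<1}"
    using space_unit_interval by auto
  ultimately have "emeasure M {0<..<1} = 0"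
    using AE_iff_measurable[of "{0<..<1}" M "\<lambda>t. t \<notin> {0<..<1}"] by blast
  with assms show False ..
qed

end

text \<open>The condition on \<open>{0<..<1}\<close> in the claim about 0 excludes measures
  concentrated at 0, including the zero measure: their moments vanish for \<open>n \<ge> 1\<close>,
  so the adjoint kills the unit vector at index 1 and 0 is an eigenvalue.\<close>

theorem theorem2p4:
  fixes M :: "real measure" and s :: "nat \<Rightarrow> real"
  assumes "sets M = sets (restrict_space borel {0..<1})"
    and "finite_measure M"
    and "ell2_bounded_operator (rhaly_moment M)"
    and "\<And>n. s n = (\<Sum>j\<le>n. moment M j)"
  shows "(\<forall>n. s n = (\<integral>t. (1 - t ^ (n + 1)) / (1 - t) \<partial>M)) \<and>
    (emeasure M {0<..<1} \<noteq> 0 \<longrightarrow>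
      (\<forall>z\<in>point_spectrum (ell2_adjoint (rhaly_moment M)). z \<noteq> 0)) \<and>
    (\<forall>\<gamma>>0. (\<forall>\<epsilon>>0. (\<lambda>n. exp (- (1 + \<epsilon>) * \<gamma> * s n)) \<in> ell1) \<longrightarrow>
      {z::complex. cmod (z - of_real (1 / \<gamma>)) < 1 / \<gamma>}
        \<subseteq> point_spectrum (ell2_adjoint (rhaly_moment M)))"
proof (intro conjI allI impI ballI subsetI)
  show "s n = (\<integral>t. (1 - t ^ (n + 1)) / (1 - t) \<partial>M)" for n
    using assms(4) sum_moment_eq[OF assms(1,2)] by simp
next
  fix z assume "emeasure M {0<..<1} \<noteq> 0" "z \<in> point_spectrum (ell2_adjoint (rhaly_moment M))"
  then show "z \<noteq> 0"
    using point_spectrum_adjoint_rhaly_nonzero[OF assms(3)[unfolded rhaly_moment_def]]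
      moment_nonzero[OF assms(1,2)] unfolding rhaly_moment_def by simp
next
  fix \<gamma> :: real and z :: complex
  assume \<gamma>: "\<gamma> > 0" and ell1: "\<forall>\<epsilon>>0. (\<lambda>n. exp (- (1 + \<epsilon>) * \<gamma> * s n)) \<in> ell1"
    and "z \<in> {z. cmod (z - of_real (1 / \<gamma>)) < 1 / \<gamma>}"
  then have disc: "cmod (z - of_real (1 / \<gamma>)) < 1 / \<gamma>"
    by simp
  note bdd = assms(3)[unfolded rhaly_moment_def]
  have z: "z \<noteq> 0" "\<gamma> < 2 * Re (1 / z)"
    using Re_inverse_gt_of_disc[OF disc] by simp_all
  \<comment> \<open>Chosen so that \<open>(1 + \<epsilon>) * \<gamma>\<close> is the exponent rate
    \<open>2 * Re (1 / z)\<close>; it is positive because \<open>z\<close> lies in the open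
    disc.\<close>
  define \<epsilon> where "\<epsilon> = 2 * Re (1 / z) / \<gamma> - 1"
  have "\<epsilon> > 0" and eps: "(1 + \<epsilon>) * \<gamma> = 2 * Re (1 / z)"
    using z \<gamma> by (simp_all add: \<epsilon>_def field_simps)
  then have "summable (\<lambda>n. exp (- (1 + \<epsilon>) * \<gamma> * s n))"
    using ell1 unfolding ell1_def by simp
  then have "summable (\<lambda>n. exp (- ((1 + \<epsilon>) * \<gamma> * s n)))"
    unfolding mult_minus_left .
  then have "summable (\<lambda>n. exp (- (2 * Re (1 / z) * (\<Sum>j\<le>n. moment M j))))"
    unfolding eps assms(4) .
  moreover have "summable (\<lambda>n. (moment M n)\<^sup>2)"
    using rhaly_bounded_imp_weights_ell2[OF bdd] by (simp add: ell2_def)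
  ultimately have "(\<lambda>k. \<Prod>j<k. (1 - of_real (moment M j) * (1 / z))) \<in> ell2"
    by (intro ell2_prod_one_minus)
  \<comment> \<open>The moments are real, so the conjugates in the required eigenvector
    disappear.\<close>
  then show "z \<in> point_spectrum (ell2_adjoint (rhaly_moment M))"
    unfolding rhaly_moment_def
    by (intro point_spectrum_adjoint_rhalyI[OF bdd z(1)]) simp
qed

end
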